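(* For each positive integer $c$, let $M_c$ be the number of gains before stopping in the truncated Petersburg game with parameter $c$, so that $P(M_c \ge m) = (1-2^{-c})^m$ for $m = 0,1,2,\ldots$, and let $V_c = M_c - (2^c-1)$ be the total net gain. Let $U$ be a random variable with the exponential distribution $P(U \ge u) = e^{-u}$, $u \ge 0$. Then, as $c \to \infty$, $2^{-c} M_c$ converges in distribution to $U$, and consequently $2^{-c} V_c$ converges in distribution to $U - 1$.
   Context: Truncated Petersburg game with doubling strategy: a fair coin is tossed until heads turns up for the first time, at time $T$, with $P(T=k)=2^{-k}$, $k=1,2,\ldots$. The player doubles the stake as long as tails comes up, and can only continue up to $c$ tosses. If $T\le c$ (probability $1-2^{-c}$) the player's net gain in the game is $1$, and the player goes on to play another independent game of the same kind. If $T>c$ (probability $2^{-c}$) the player loses $2^c-1$ and must stop. $M_c$ denotes the number of games won (each giving net gain $1$) before the player stops, and $V_c = M_c-(2^c-1)$ is the total net gain when the player stops. *)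

theory Defs
  imports "HOL-Probability.Probability"
begin

text \<open>An infinite supply of independent rounds of coin tossing: \<open>T i\<close> is the time of the
  first heads in round \<open>i\<close> (rounds are numbered from 0). The truncation parameter \<open>c\<close> only
  determines when the player stops.\<close>

locale petersburg_games = prob_space M for M :: "'a measure" +
  fixes T :: "nat \<Rightarrow> 'a \<Rightarrow> nat"
  assumes indep_T: "indep_vars (\<lambda>_. count_space UNIV) T UNIV"
    and prob_T: "\<And>i k. k \<ge> 1 \<Longrightarrow> prob {\<omega> \<in> space M. T i \<omega> = k} = (1 / 2) ^ k"

text \<open>Game \<open>i\<close> is played and won iff heads came within \<open>c\<close> tosses in it and in all previous
  games, since the first lost game makes the player stop. On the null event that no game is
  ever lost the set below is infinite, and \<open>games_won\<close> takes the junk value 0.\<close>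

definition games_won :: "nat \<Rightarrow> (nat \<Rightarrow> 'a \<Rightarrow> nat) \<Rightarrow> 'a \<Rightarrow> nat" where
  "games_won c T \<omega> = card {i. \<forall>j\<le>i. T j \<omega> \<le> c}"

definition total_net_gain :: "nat \<Rightarrow> (nat \<Rightarrow> 'a \<Rightarrow> nat) \<Rightarrow> 'a \<Rightarrow> real" where
  "total_net_gain c T \<omega> = real (games_won c T \<omega>) - (2 ^ c - 1)"

end

theory Submission
  imports Defs "HOL-Real_Asymp.Real_Asymp"
begin

text \<open>Almost surely some game is lost, and then \<open>games_won c T\<close> is the index of the first lost
  game, a geometric variable with failure probability \<open>2\<^sup>-\<^sup>c\<close>. Its rescaled distribution function
  at \<open>y\<close> is \<open>1 - (1 - 2\<^sup>-\<^sup>c)\<^sup>n\<close> with \<open>n\<close> close to \<open>2\<^sup>c max 0 y\<close>. The limit \<open>1 - exp (- max 0 y)\<close> is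
  approached along every convergent sequence of arguments, which also absorbs the vanishing
  part of the shift \<open>1 - 2\<^sup>-\<^sup>c\<close> that separates the net gain from the number of wins.\<close>

text \<open>The counted set is the initial segment below the first lost game. Since games are
  numbered from 0, its cardinality is the index of that game.\<close>

lemma games_won_eq_Least:
  assumes "\<exists>i. T i \<omega> > c"
  shows "games_won c T \<omega> = (LEAST i. T i \<omega> > c)"
proof -
  define N where "N = (LEAST i. T i \<omega> > c)"
  have N: "T N \<omega> > c"
    unfolding N_def using assms by (rule LeastI_ex)
  have before: "T j \<omega> \<le> c" if "j < N" for j
    using not_less_Least[of j "\<lambda>i. T i \<omega> > c"] that by (simp add: N_def)
  have "{i. \<forall>j\<le>i. T j \<omega> \<le> c} = {..<N}"
    using N before by (force simp: not_le[symmetric])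
  thus ?thesis
    by (simp add: games_won_def N_def)
qed

text \<open>This turns the tail event of the count into a finite intersection over separate games,
  to which independence applies.\<close>

lemma le_games_won_iff:
  assumes "\<exists>i. T i \<omega> > c"
  shows "m \<le> games_won c T \<omega> \<longleftrightarrow> (\<forall>j<m. T j \<omega> \<le> c)"
proof -
  have "c < T (LEAST i. T i \<omega> > c) \<omega>"
    using assms by (rule LeastI_ex)
  moreover have "T j \<omega> \<le> c" if "j < (LEAST i. T i \<omega> > c)" for j
    using not_less_Least[OF that] by (simp add: not_less)
  ultimately show ?thesis
    unfolding games_won_eq_Least[of c T \<omega>, OF assms] by (meson leD leI less_le_trans)
qed

context petersburg_games
begin

lemma measurable_T [measurable]: "T i \<in> M \<rightarrow>\<^sub>M count_space UNIV"
  using indep_T by (auto simp: indep_vars_def)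

text \<open>The law of \<open>T i\<close> is prescribed only at positive values. These masses
  already add up to 1, so the value 0 is null, which starts the induction on
  \<open>c\<close>.\<close>

lemma prob_T_le: "prob {\<omega> \<in> space M. T i \<omega> \<le> c} = 1 - (1 / 2) ^ c"
proof -
  have "(\<lambda>k. prob {\<omega> \<in> space M. T i \<omega> = Suc k}) sums prob (\<Union>k. {\<omega> \<in> space M. T i \<omega> = Suc k})"
    by (rule finite_measure_UNION) (auto simp: disjoint_family_on_def)
  moreover have "prob {\<omega> \<in> space M. T i \<omega> = Suc k} = (1 / 2) ^ Suc k" for k
    by (rule prob_T) simp
  ultimately have "prob (\<Union>k. {\<omega> \<in> space M. T i \<omega> = Suc k}) = 1"
    using power_half_series by (simp only: sums_unique2)
  also have "(\<Union>k. {\<omega> \<in> space M. T i \<omega> = Suc k}) = {\<omega> \<in> space M. T i \<omega> \<noteq> 0}"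
    by (auto simp: not0_implies_Suc)
  finally have "prob {\<omega> \<in> space M. T i \<omega> \<noteq> 0} = 1" .
  hence zero: "prob {\<omega> \<in> space M. T i \<omega> = 0} = 0"
    by (subst (asm) prob_neg) auto
  show ?thesis
  proof (induction c)
    case 0
    thus ?case using zero by simp
  next
    case (Suc c)
    have "{\<omega> \<in> space M. T i \<omega> \<le> Suc c} = {\<omega> \<in> space M. T i \<omega> \<le> c} \<union> {\<omega> \<in> space M. T i \<omega> = Suc c}"
      by auto
    also have "prob \<dots> = prob {\<omega> \<in> space M. T i \<omega> \<le> c} + prob {\<omega> \<in> space M. T i \<omega> = Suc c}"
      by (rule finite_measure_Union) auto
    finally show ?case
      by (simp add: Suc prob_T)
  qed
qed

lemma prob_all_T_le: "prob {\<omega> \<in> space M. \<forall>j<m. T j \<omega> \<le> c} = (1 - (1 / 2) ^ c) ^ m"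
proof (cases "m = 0")
  \<comment> \<open>For \<open>m = 0\<close> the indexed intersection would be \<open>UNIV\<close>
    instead of \<open>space M\<close>, so that case is kept apart.\<close>
  case False
  have "prob (\<Inter>j\<in>{..<m}. T j -` {..c} \<inter> space M) = (\<Prod>j\<in>{..<m}. prob (T j -` {..c} \<inter> space M))"
    using False by (intro indep_varsD[OF indep_T]) auto
  moreover have "(\<Inter>j\<in>{..<m}. T j -` {..c} \<inter> space M) = {\<omega> \<in> space M. \<forall>j<m. T j \<omega> \<le> c}"
    using False by auto
  moreover have "T j -` {..c} \<inter> space M = {\<omega> \<in> space M. T j \<omega> \<le> c}" for j
    by auto
  ultimately show ?thesis
    by (simp add: prob_T_le)
qed (simp add: prob_space)

text \<open>Winning forever implies winning the first \<open>m\<close> games for every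
  \<open>m\<close>, and the probabilities of these events tend to 0 geometrically.\<close>

lemma AE_game_lost: "AE \<omega> in M. \<exists>i. T i \<omega> > c"
proof -
  have "prob {\<omega> \<in> space M. \<forall>i. T i \<omega> \<le> c} \<le> (1 - (1 / 2) ^ c) ^ m" for m
    unfolding prob_all_T_le[symmetric] by (intro finite_measure_mono) auto
  moreover have "(\<lambda>m. (1 - (1 / 2) ^ c) ^ m) \<longlonglongrightarrow> (0 :: real)"
    by (rule LIMSEQ_power_zero) (simp add: power_le_one)
  ultimately have "prob {\<omega> \<in> space M. \<forall>i. T i \<omega> \<le> c} \<le> 0"
    by (intro LIMSEQ_le_const) auto
  hence "prob {\<omega> \<in> space M. \<forall>i. T i \<omega> \<le> c} = 0"
    by (simp add: measure_le_0_iff)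
  hence "AE \<omega> in M. \<not> (\<forall>i. T i \<omega> \<le> c)"
    by (subst (asm) prob_eq_0) (auto elim!: AE_mp)
  thus ?thesis
    by (simp add: not_le)
qed

lemma measurable_games_won [measurable]: "games_won c T \<in> M \<rightarrow>\<^sub>M count_space UNIV"
proof -
  have "games_won c T = (\<lambda>\<omega>. if \<exists>i. T i \<omega> > c then LEAST i. T i \<omega> > c else 0)"
    \<comment> \<open>If no game is lost, the counted set is \<open>UNIV\<close>, whose
      \<open>card\<close> is 0; this is the \<open>else\<close> value.\<close>
    by (rule ext) (simp add: games_won_eq_Least, simp add: games_won_def not_less)
  thus ?thesis by simp
qed

lemma prob_games_won_ge: "prob {\<omega> \<in> space M. m \<le> games_won c T \<omega>} = (1 - (1 / 2) ^ c) ^ m"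
proof -
  have "prob {\<omega> \<in> space M. m \<le> games_won c T \<omega>} = prob {\<omega> \<in> space M. \<forall>j<m. T j \<omega> \<le> c}"
    \<comment> \<open>The two events agree only almost surely: if no game is ever lost, the count
      has the junk value 0.\<close>
    using AE_game_lost[of c] by (intro finite_measure_eq_AE) (auto simp: le_games_won_iff)
  thus ?thesis by (simp add: prob_all_T_le)
qed

text \<open>The count is an integer, so not exceeding \<open>2 ^ c * y\<close> means staying below
  \<open>\<lfloor>2 ^ c * y\<rfloor> + 1\<close>. For negative \<open>y\<close>, \<open>nat\<close>
  makes the exponent 0 and the probability 0.\<close>

lemma prob_scaled_games_won_le:
  "prob {\<omega> \<in> space M. real (games_won c T \<omega>) / 2 ^ c \<le> y} = 1 - (1 - (1 / 2) ^ c) ^ nat (\<lfloor>2 ^ c * y\<rfloor> + 1)"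
proof -
  have *: "real k / 2 ^ c \<le> y \<longleftrightarrow> \<not> nat (\<lfloor>2 ^ c * y\<rfloor> + 1) \<le> k" for k
  proof -
    have "real k / 2 ^ c \<le> y \<longleftrightarrow> real k \<le> 2 ^ c * y"
      by (simp add: field_simps)
    also have "\<dots> \<longleftrightarrow> int k \<le> \<lfloor>2 ^ c * y\<rfloor>"
      by (simp add: le_floor_iff)
    finally show ?thesis by linarith
  qed
  show ?thesis
    unfolding * by (subst prob_neg) (auto simp: prob_games_won_ge)
qed

end

text \<open>The power is written as the exponential of \<open>n c / 2 ^ c\<close> times
  \<open>2 ^ c * ln (1 - (1 / 2) ^ c)\<close>. The first factor is squeezed to
  \<open>max 0 l\<close>, the second tends to -1.\<close>

lemma tendsto_scaled_geometric_tail: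
  fixes y :: "nat \<Rightarrow> real"
  assumes "y \<longlonglongrightarrow> l"
  shows "(\<lambda>c. (1 - (1 / 2) ^ c) ^ nat (\<lfloor>2 ^ c * y c\<rfloor> + 1)) \<longlonglongrightarrow> exp (- max 0 l)"
proof -
  define n where "n = (\<lambda>c. nat (\<lfloor>2 ^ c * y c\<rfloor> + 1))"
  have lower: "max 0 (y c) \<le> real (n c) / 2 ^ c"
    and upper: "real (n c) / 2 ^ c \<le> max 0 (y c) + (1 / 2) ^ c" for c
  proof -
    have "2 ^ c * max 0 (y c) = max 0 (2 ^ c * y c)"
      by (simp add: max_mult_distrib_left)
    \<comment> \<open>Rounding costs at most 1, which becomes \<open>(1 / 2) ^ c\<close> after
      division by \<open>2 ^ c\<close>.\<close>
    moreover have "max 0 z \<le> real (nat (\<lfloor>z\<rfloor> + 1))" "real (nat (\<lfloor>z\<rfloor> + 1)) \<le> max 0 z + 1" for z :: real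
      by linarith+
    ultimately have "2 ^ c * max 0 (y c) \<le> real (n c)" "real (n c) \<le> 2 ^ c * max 0 (y c) + 1"
      by (simp_all add: n_def)
    moreover have "z \<le> k / 2 ^ c" "k / 2 ^ c \<le> z + (1 / 2) ^ c"
      if "2 ^ c * z \<le> k" "k \<le> 2 ^ c * z + 1" for z k :: real
      using that by (simp_all add: field_simps)
    ultimately show "max 0 (y c) \<le> real (n c) / 2 ^ c" "real (n c) / 2 ^ c \<le> max 0 (y c) + (1 / 2) ^ c"
      by blast+
  qed
  have max: "(\<lambda>c. max 0 (y c)) \<longlonglongrightarrow> max 0 l"
    by (intro tendsto_max tendsto_const assms)
  have "(\<lambda>c. max 0 (y c) + (1 / 2) ^ c) \<longlonglongrightarrow> max 0 l + 0"
    by (intro tendsto_add max LIMSEQ_power_zero) simp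
  hence sum: "(\<lambda>c. max 0 (y c) + (1 / 2) ^ c) \<longlonglongrightarrow> max 0 l"
    by simp
  have ratio: "(\<lambda>c. real (n c) / 2 ^ c) \<longlonglongrightarrow> max 0 l"
    by (rule tendsto_sandwich[OF always_eventually always_eventually max sum]) (intro allI lower upper)+
  have "((\<lambda>x :: real. x * ln (1 - 1 / x)) \<longlongrightarrow> - 1) at_top"
    by real_asymp
  moreover have "filterlim (\<lambda>c. 2 ^ c :: real) at_top sequentially"
    by real_asymp
  ultimately have "(\<lambda>c. 2 ^ c * ln (1 - 1 / 2 ^ c)) \<longlonglongrightarrow> (- 1 :: real)"
    by (rule filterlim_compose)
  hence exponent: "(\<lambda>c. 2 ^ c * ln (1 - (1 / 2) ^ c)) \<longlonglongrightarrow> (- 1 :: real)"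
    by (simp add: power_one_over)
  \<comment> \<open>For \<open>c = 0\<close> the base of the power is 0 and is not the exponential
    of its logarithm.\<close>
  have eq: "exp (real (n c) / 2 ^ c * (2 ^ c * ln (1 - (1 / 2) ^ c))) = (1 - (1 / 2) ^ c) ^ n c"
    if "c \<ge> 1" for c
  proof -
    have "(1 / 2) ^ c < (1 :: real)"
      using that by (simp add: power_less_one_iff)
    thus ?thesis
      by (simp add: exp_of_nat_mult)
  qed
  from tendsto_exp[OF tendsto_mult[OF ratio exponent]]
  have "(\<lambda>c. exp (real (n c) / 2 ^ c * (2 ^ c * ln (1 - (1 / 2) ^ c)))) \<longlonglongrightarrow> exp (- max 0 l)"
    by simp
  moreover have "\<forall>\<^sub>F c in sequentially.
      exp (real (n c) / 2 ^ c * (2 ^ c * ln (1 - (1 / 2) ^ c))) = (1 - (1 / 2) ^ c) ^ n c"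
    by (rule eventually_mono[OF eventually_ge_at_top eq])
  ultimately show ?thesis
    unfolding n_def by (rule Lim_transform_eventually)
qed

text \<open>The tail \<open>U x \<ge> y\<close> and the event \<open>U x \<le> y\<close> overlap
  exactly in the atom at \<open>y\<close>, which is assumed null. For negative \<open>y\<close> the
  tail at 0 already carries all the mass.\<close>

lemma (in prob_space) prob_le_exponential:
  fixes U :: "'a \<Rightarrow> real"
  assumes [measurable]: "U \<in> borel_measurable M"
    and tail: "\<And>u. u \<ge> 0 \<Longrightarrow> prob {x \<in> space M. U x \<ge> u} = exp (- u)"
    and atom: "prob {x \<in> space M. U x = y} = 0"
  shows "prob {x \<in> space M. U x \<le> y} = 1 - exp (- max 0 y)"
proof -
  have "{x \<in> space M. U x \<le> y} = {x \<in> space M. \<not> U x \<ge> y} \<union> {x \<in> space M. U x = y}"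
    by auto
  also have "prob \<dots> = prob {x \<in> space M. \<not> U x \<ge> y} + prob {x \<in> space M. U x = y}"
    by (rule finite_measure_Union) auto
  finally have "prob {x \<in> space M. U x \<le> y} = 1 - prob {x \<in> space M. U x \<ge> y}"
    using atom prob_neg[of "\<lambda>x. U x \<ge> y"] by simp
  also have "prob {x \<in> space M. U x \<ge> y} = exp (- max 0 y)"
  proof (cases "y \<ge> 0")
    case True
    thus ?thesis by (simp add: tail)
  next
    case False
    have "prob {x \<in> space M. U x \<ge> 0} \<le> prob {x \<in> space M. U x \<ge> y}"
      using False by (intro finite_measure_mono) auto
    hence "prob {x \<in> space M. U x \<ge> y} = 1"
      using tail[of 0] by (simp add: antisym)
    thus ?thesis using False by simp
  qed
  finally show ?thesis .
qed

lemma cdf_distr: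
  assumes "f \<in> borel_measurable M"
  shows "cdf (distr M borel f) x = measure M {\<omega> \<in> space M. f \<omega> \<le> x}"
proof -
  have "f -` {..x} \<inter> space M = {\<omega> \<in> space M. f \<omega> \<le> x}"
    by auto
  thus ?thesis
    using assms by (simp add: cdf_def measure_distr)
qed

text \<open>The shift \<open>s\<close> lets one statement serve both limits: it is 0 for the number
  of wins and \<open>1 - (1 / 2) ^ c\<close> for the net gain.\<close>

lemma weak_conv_m_games_won:
  fixes U :: "'b \<Rightarrow> real" and s :: "nat \<Rightarrow> real"
  assumes games: "\<And>c. c \<ge> 1 \<Longrightarrow> petersburg_games (P c) (T c)"
    and "prob_space Q"
    and U [measurable]: "U \<in> borel_measurable Q"
    and tail: "\<And>u. u \<ge> 0 \<Longrightarrow> measure Q {x \<in> space Q. U x \<ge> u} = exp (- u)"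
    and s: "s \<longlonglongrightarrow> t"
  shows "weak_conv_m (\<lambda>c. distr (P c) borel (\<lambda>\<omega>. real (games_won c (T c) \<omega>) / 2 ^ c - s c))
           (distr Q borel (\<lambda>x. U x - t))"
  unfolding weak_conv_m_def weak_conv_def
proof (intro allI impI)
  fix x
  interpret Q: prob_space Q by fact
  interpret D: prob_space "distr Q borel (\<lambda>x. U x - t)"
    by (rule Q.prob_space_distr) simp
  interpret D: real_distribution "distr Q borel (\<lambda>x. U x - t)"
    by standard auto
  \<comment> \<open>Only continuity points of the limit matter, and continuity at \<open>x\<close>
    says that \<open>U\<close> has no atom at \<open>x + t\<close>.\<close>
  assume "isCont (cdf (distr Q borel (\<lambda>x. U x - t))) x"
  hence "measure (distr Q borel (\<lambda>x. U x - t)) {x} = 0"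
    by (simp add: D.isCont_cdf)
  moreover have "(\<lambda>x. U x - t) -` {x} \<inter> space Q = {z \<in> space Q. U z = x + t}"
    by auto
  ultimately have "Q.prob {z \<in> space Q. U z = x + t} = 0"
    by (simp add: measure_distr)
  from Q.prob_le_exponential[OF U tail this]
  have lim: "cdf (distr Q borel (\<lambda>x. U x - t)) x = 1 - exp (- max 0 (x + t))"
    by (simp add: cdf_distr diff_le_eq)
  \<comment> \<open>Subtracting \<open>s c\<close> from the variable amounts to evaluating the
    unshifted distribution function at \<open>x + s c\<close>.\<close>
  have cdf_c: "1 - (1 - (1 / 2) ^ c) ^ nat (\<lfloor>2 ^ c * (x + s c)\<rfloor> + 1) =
      cdf (distr (P c) borel (\<lambda>\<omega>. real (games_won c (T c) \<omega>) / 2 ^ c - s c)) x" if "c \<ge> 1" for c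
  proof -
    interpret petersburg_games "P c" "T c"
      by (rule games[OF that])
    show ?thesis
      by (subst cdf_distr) (simp_all add: diff_le_eq prob_scaled_games_won_le)
  qed
  have "(\<lambda>c. 1 - (1 - (1 / 2) ^ c) ^ nat (\<lfloor>2 ^ c * (x + s c)\<rfloor> + 1)) \<longlonglongrightarrow> 1 - exp (- max 0 (x + t))"
    by (intro tendsto_diff tendsto_const tendsto_scaled_geometric_tail tendsto_add s)
  thus "(\<lambda>c. cdf (distr (P c) borel (\<lambda>\<omega>. real (games_won c (T c) \<omega>) / 2 ^ c - s c)) x)
      \<longlonglongrightarrow> cdf (distr Q borel (\<lambda>x. U x - t)) x"
    unfolding lim
    by (rule Lim_transform_eventually) (rule eventually_mono[OF eventually_ge_at_top[of 1] cdf_c])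
qed

theorem theorem2p1:
  fixes P :: "nat \<Rightarrow> 'a measure" and T :: "nat \<Rightarrow> nat \<Rightarrow> 'a \<Rightarrow> nat"
    and Q :: "'b measure" and U :: "'b \<Rightarrow> real"
  assumes games: "\<And>c. c \<ge> 1 \<Longrightarrow> petersburg_games (P c) (T c)"
    and Q: "prob_space Q"
    and U_meas: "U \<in> borel_measurable Q"
    and U_exp: "\<And>u. u \<ge> 0 \<Longrightarrow> measure Q {x \<in> space Q. U x \<ge> u} = exp (- u)"
  shows "(\<forall>c\<ge>1. \<forall>m. measure (P c) {\<omega> \<in> space (P c). games_won c (T c) \<omega> \<ge> m} = (1 - (1 / 2) ^ c) ^ m)
    \<and> weak_conv_m (\<lambda>c. distr (P c) borel (\<lambda>\<omega>. real (games_won c (T c) \<omega>) / 2 ^ c))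
           (distr Q borel U)
    \<and> weak_conv_m (\<lambda>c. distr (P c) borel (\<lambda>\<omega>. total_net_gain c (T c) \<omega> / 2 ^ c))
           (distr Q borel (\<lambda>x. U x - 1))"
proof (intro conjI allI impI)
  fix c m :: nat
  assume "c \<ge> 1"
  then interpret petersburg_games "P c" "T c"
    by (rule games)
  show "prob {\<omega> \<in> space (P c). games_won c (T c) \<omega> \<ge> m} = (1 - (1 / 2) ^ c) ^ m"
    by (rule prob_games_won_ge)
next
  show "weak_conv_m (\<lambda>c. distr (P c) borel (\<lambda>\<omega>. real (games_won c (T c) \<omega>) / 2 ^ c)) (distr Q borel U)"
    using weak_conv_m_games_won[OF games Q U_meas U_exp tendsto_const[of 0]] by simp
next
  \<comment> \<open>The final loss \<open>2 ^ c - 1\<close> rescales to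
    \<open>1 - (1 / 2) ^ c\<close>, a deterministic shift tending to 1.\<close>
  have "total_net_gain c T' \<omega> / 2 ^ c = real (games_won c T' \<omega>) / 2 ^ c - (1 - (1 / 2) ^ c)"
    for c and T' :: "nat \<Rightarrow> 'a \<Rightarrow> nat" and \<omega>
    by (simp add: total_net_gain_def field_simps)
  moreover have "(\<lambda>c. 1 - (1 / 2) ^ c) \<longlonglongrightarrow> (1 :: real)"
    by real_asymp
  ultimately show "weak_conv_m (\<lambda>c. distr (P c) borel (\<lambda>\<omega>. total_net_gain c (T c) \<omega> / 2 ^ c))
      (distr Q borel (\<lambda>x. U x - 1))"
    using weak_conv_m_games_won[OF games Q U_meas U_exp] by simp
qed

end
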